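(* The real algebra $\mathbb{R}^3_{\circledast}$ (the vector space $\mathbb{R}^3$ with the $\circledast$-product) is isomorphic, as an algebra over $\mathbb{R}$, to the direct sum $\mathbb{R}\oplus\mathbb{C}$: $$\mathbb{R}^3_{\circledast}\cong\mathbb{R}\oplus\mathbb{C}.$$
   Context: $\mathbb{R}^3_{\circledast}$ is the real vector space $\mathbb{R}^3$ with the bilinear product $$(a,b,c)\circledast(u,v,w)=(au-bw-cv,\; av+bu-cw,\; aw+bv+cu).$$ It is a commutative associative unital algebra over $\mathbb{R}$ with unity $\mathbf{1}=(1,0,0)$. $\mathbb{R}\oplus\mathbb{C}=\{(r,z): r\in\mathbb{R},\ z\in\mathbb{C}\}$ is the real algebra with componentwise addition and real scalar multiplication and product $(r_1,z_1)\otimes(r_2,z_2)=(r_1r_2,\,z_1z_2)$; its unity is $(1,1)$. Isomorphisms of algebras are $\mathbb{R}$-linear, multiplicative bijections sending unity to unity. *)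

theory Defs
  imports "HOL-Analysis.Analysis"
begin

definition circ_mult :: "real ^ 3 \<Rightarrow> real ^ 3 \<Rightarrow> real ^ 3"  (infixl "\<circledast>" 70) where
  "x \<circledast> y = vector
     [x $ 1 * y $ 1 - x $ 2 * y $ 3 - x $ 3 * y $ 2,
      x $ 1 * y $ 2 + x $ 2 * y $ 1 - x $ 3 * y $ 3,
      x $ 1 * y $ 3 + x $ 2 * y $ 2 + x $ 3 * y $ 1]"

definition circ_one :: "real ^ 3" where
  "circ_one = vector [1, 0, 0]"

definition dsum_mult :: "real \<times> complex \<Rightarrow> real \<times> complex \<Rightarrow> real \<times> complex"
    (infixl "\<otimes>" 70) where
  "p \<otimes> q = (fst p * fst q, snd p * snd q)"

definition dsum_one :: "real \<times> complex" where
  "dsum_one = (1, 1)"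

definition comm_unital_algebra :: "('a::real_vector \<Rightarrow> 'a \<Rightarrow> 'a) \<Rightarrow> 'a \<Rightarrow> bool" where
  "comm_unital_algebra mul e \<longleftrightarrow>
     bilinear mul \<and>
     (\<forall>x y z. mul (mul x y) z = mul x (mul y z)) \<and>
     (\<forall>x y. mul x y = mul y x) \<and>
     (\<forall>x. mul e x = x)"

definition algebra_iso ::
  "('a::real_vector \<Rightarrow> 'a \<Rightarrow> 'a) \<Rightarrow> 'a \<Rightarrow> ('b::real_vector \<Rightarrow> 'b \<Rightarrow> 'b) \<Rightarrow> 'b \<Rightarrow> ('a \<Rightarrow> 'b) \<Rightarrow> bool" where
  "algebra_iso mul1 e1 mul2 e2 f \<longleftrightarrow>
     linear f \<and> bij f \<and> (\<forall>x y. f (mul1 x y) = mul2 (f x) (f y)) \<and> f e1 = e2"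

definition algebra_isomorphic ::
  "('a::real_vector \<Rightarrow> 'a \<Rightarrow> 'a) \<Rightarrow> 'a \<Rightarrow> ('b::real_vector \<Rightarrow> 'b \<Rightarrow> 'b) \<Rightarrow> 'b \<Rightarrow> bool" where
  "algebra_isomorphic mul1 e1 mul2 e2 \<longleftrightarrow> (\<exists>f. algebra_iso mul1 e1 mul2 e2 f)"

lemma circ_mult_triple:
  "(vector [a, b, c] :: real ^ 3) \<circledast> vector [u, v, w] =
     vector [a * u - b * w - c * v, a * v + b * u - c * w, a * w + b * v + c * u]"
  by (simp add: circ_mult_def)

lemma dsum_mult_pair: "(r1, z1) \<otimes> (r2, z2) = (r1 * r2, z1 * z2)"
  by (simp add: dsum_mult_def)

lemma comm_unital_algebra_circ: "comm_unital_algebra (\<circledast>) circ_one"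
  unfolding comm_unital_algebra_def bilinear_def
  by (auto simp: circ_mult_def circ_one_def vec_eq_iff forall_3 algebra_simps intro!: linearI)

lemma comm_unital_algebra_dsum: "comm_unital_algebra (\<otimes>) dsum_one"
  unfolding comm_unital_algebra_def bilinear_def
  by (auto simp: dsum_mult_def dsum_one_def algebra_simps intro!: linearI)

end

theory Submission
  imports Defs
begin

text \<open>
  The algebra is \<open>\<real>[t]/(t\<^sup>3 + 1)\<close>, with \<open>(a, b, c)\<close> standing for \<open>a + b t + c t\<^sup>2\<close>.
  Since \<open>t\<^sup>3 + 1 = (t + 1)(t\<^sup>2 - t + 1)\<close>, evaluation at the real root \<open>-1\<close> and at the
  complex root \<open>\<omega> = (1 + i \<surd>3) / 2\<close> gives the isomorphism of the Chinese remainder theorem.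
\<close>

definition eval_roots :: "real ^ 3 \<Rightarrow> real \<times> complex" where
  "eval_roots x =
     (x $ 1 - x $ 2 + x $ 3,
      Complex (x $ 1 + (x $ 2 - x $ 3) / 2) (sqrt 3 / 2 * (x $ 2 + x $ 3)))"

text \<open>With \<open>(a, b, c)\<close> the sought coefficients, \<open>d\<close> recovers
  \<open>b - c\<close> from the gap between the two real parts and \<open>s\<close> recovers
  \<open>b + c\<close> from the imaginary part.\<close>

definition interpolate_roots :: "real \<times> complex \<Rightarrow> real ^ 3" where
  "interpolate_roots p =
     (let d = 2 * (Re (snd p) - fst p) / 3; s = 2 * Im (snd p) / sqrt 3
      in vector [fst p + d, (s + d) / 2, (s - d) / 2])"

lemma interpolate_eval_roots: "interpolate_roots (eval_roots x) = x"
  by (simp add: interpolate_roots_def eval_roots_def Let_def vec_eq_iff forall_3 field_simps)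

lemma eval_interpolate_roots: "eval_roots (interpolate_roots p) = p"
  by (simp add: interpolate_roots_def eval_roots_def Let_def prod_eq_iff complex_eq_iff field_simps)

lemma bij_eval_roots: "bij eval_roots"
  by (rule bij_betw_byWitness[where f' = interpolate_roots])
    (simp_all add: interpolate_eval_roots eval_interpolate_roots)

lemma linear_eval_roots: "linear eval_roots"
  by (rule linearI) (simp_all add: eval_roots_def complex_eq_iff field_simps)

text \<open>The product \<open>\<circledast>\<close> multiplies polynomials modulo
  \<open>t^3 = -1\<close>, a relation that both roots satisfy, so evaluation respects it.\<close>

lemma eval_roots_mult: "eval_roots (x \<circledast> y) = eval_roots x \<otimes> eval_roots y"
proof -
  \<comment> \<open>Two imaginary parts, each with a factor \<open>sqrt 3\<close>, meet in the real
    part of the complex product; the nesting matches the form given by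
    \<open>field_simps\<close>.\<close>
  have sqrt3: "sqrt 3 * (sqrt 3 * r) = 3 * r" for r :: real
    by (simp flip: mult.assoc)
  show ?thesis
    by (simp add: eval_roots_def circ_mult_def dsum_mult_def complex_eq_iff field_simps sqrt3)
qed

lemma eval_roots_one: "eval_roots circ_one = dsum_one"
  by (simp add: eval_roots_def circ_one_def dsum_one_def complex_eq_iff)

theorem theorem1p5:
  "algebra_isomorphic (\<circledast>) circ_one (\<otimes>) dsum_one"
  unfolding algebra_isomorphic_def algebra_iso_def
  using linear_eval_roots bij_eval_roots eval_roots_mult eval_roots_one by blast

end
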